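(* There exists a function $N:\mathbb{N}\to\mathbb{N}$ such that for every positive integer $d$, every $S\subset\mathbb{R}^d$ and every family $F$ of axis-parallel boxes in $\mathbb{R}^d$ with $|F|=N(d)$, if every pair of members of $F$ is $S$-intersecting, then $F$ contains an $S$-intersecting subfamily of size $d+1$.
   Context: $\mathbb{N}$ is the set of positive integers. An axis-parallel box in $\mathbb{R}^d$ is a product of $d$ nonempty closed intervals of $\mathbb{R}$ (all boxes are closed). A family is a finite indexed collection $\{B_1,\dots,B_n\}$, possibly with repeated members, and $|F|=n$; pairs are pairs of distinct indices. Given a set $S$, a nonempty (sub)family of sets is $S$-intersecting if the intersection of all its members contains a point of $S$. *)

theory Defs
  imports "HOL-Analysis.Analysis"
begin

text \<open>The dimension is quantified inside the statement, so points of d-dimensional real space are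
  represented as functions on \<open>{..<d}\<close>, extensional in the sense of \<^theory>\<open>HOL-Library.FuncSet\<close>.\<close>

definition real_space :: "nat \<Rightarrow> (nat \<Rightarrow> real) set" where
  "real_space d = {..<d} \<rightarrow>\<^sub>E UNIV"

text \<open>A closed interval is an interval that is a closed set: besides \<open>{a..b}\<close> with \<open>a \<le> b\<close>, this
  allows closed rays and the whole line.\<close>

definition axis_parallel_box :: "nat \<Rightarrow> (nat \<Rightarrow> real) set \<Rightarrow> bool" where
  "axis_parallel_box d B \<longleftrightarrow>
     (\<exists>I :: nat \<Rightarrow> real set.
        (\<forall>i<d. is_interval (I i) \<and> closed (I i) \<and> I i \<noteq> {}) \<and> B = (\<Pi>\<^sub>E i\<in>{..<d}. I i))"

text \<open>A subfamily of an indexed family \<open>B\<close> is given by its index set \<open>J\<close>, so that repeated members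
  are counted with multiplicity.\<close>

definition intersecting :: "'a set \<Rightarrow> ('i \<Rightarrow> 'a set) \<Rightarrow> 'i set \<Rightarrow> bool" where
  "intersecting S B J \<longleftrightarrow> J \<noteq> {} \<and> (\<Inter>j\<in>J. B j) \<inter> S \<noteq> {}"

end

theory Submission
  imports Defs "HOL-Library.Ramsey"
begin

text \<open>Choose a point \<open>p i j \<in> S\<close> in each pairwise intersection \<open>B i \<inter> B j\<close>. For \<open>i < k < j\<close>, either
  \<open>p i j \<in> B k\<close>, or some coordinate of \<open>p i j\<close> lies strictly on one side of \<open>B k\<close>; this colours the
  triples of indices with \<open>2 * d + 1\<close> colours. By Ramsey's theorem there is a large homogeneous set
  of indices. It cannot have a separating colour: if \<open>h0 < h1 < h2 < h3\<close> are homogeneous, say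
  with \<open>p i j\<close> above \<open>B k\<close> in coordinate \<open>c\<close>, then \<open>p h0 h2\<close> is above \<open>p h1 h3 \<in> B h1\<close>, which
  is in turn above \<open>p h0 h2 \<in> B h2\<close>. So the point \<open>p i j\<close> for the least \<open>i\<close> and the greatest \<open>j\<close> of
  the homogeneous set is common to all its boxes.\<close>

text \<open>Three distinct numbers have only one increasing arrangement, so colouring increasing
  triples amounts to colouring 3-element sets, to which Ramsey's theorem applies. \<open>Q\<close>
  is a relation because several colours may fit the same triple; one of them is chosen for
  each.\<close>

lemma ramsey_ordered_triples:
  fixes n M :: nat
  shows "\<exists>N>0. \<forall>Q :: nat \<Rightarrow> nat \<Rightarrow> nat \<Rightarrow> nat \<Rightarrow> bool.
    (\<forall>i k j. i < k \<longrightarrow> k < j \<longrightarrow> j < N \<longrightarrow> (\<exists>m<n. Q m i k j)) \<longrightarrow>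
    (\<exists>m<n. \<exists>H\<subseteq>{..<N}. card H = M \<and>
       (\<forall>i\<in>H. \<forall>k\<in>H. \<forall>j\<in>H. i < k \<longrightarrow> k < j \<longrightarrow> Q m i k j))"
proof -
  obtain N0 :: nat where N0: "partn_lst {..<N0} (replicate n M) 3"
    using ramsey_full by blast
  \<comment> \<open>The successor secures \<open>N > 0\<close>, since the bound from Ramsey's
    theorem may be zero; enlarging the bound keeps the partition property.\<close>
  define N where "N = Suc N0"
  have part: "partn_lst {..<N} (replicate n M) 3"
    using partn_lst_greater_resource[OF N0] by (simp add: N_def)
  show ?thesis
  proof (rule exI[of _ N], intro conjI allI impI)
    show "N > 0" by (simp add: N_def)
  next
    fix Q :: "nat \<Rightarrow> nat \<Rightarrow> nat \<Rightarrow> nat \<Rightarrow> bool"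
    assume Q: "\<forall>i k j. i < k \<longrightarrow> k < j \<longrightarrow> j < N \<longrightarrow> (\<exists>m<n. Q m i k j)"
    define R where "R T m \<longleftrightarrow> m < n \<and> (\<forall>i k j. i < k \<longrightarrow> k < j \<longrightarrow> T = {i,k,j} \<longrightarrow> Q m i k j)" for T m
    have unique: "i = i' \<and> k = k' \<and> j = j'"
      if "i < k" "k < j" "i' < k'" "k' < j'" "{i,k,j} = {i',k',j'}" for i k j i' k' j' :: nat
      using sorted_distinct_set_unique[of "[i,k,j]" "[i',k',j']"] that by auto
    have "\<exists>m. R T m" if T3: "T \<in> nsets {..<N} 3" for T
    proof -
      obtain i k j where T: "T = {i,k,j}" "i < k" "k < j" "j \<in> {..<N}"
        using T3 unfolding ordered_nsets_3_eq by blast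
      then obtain m where "m < n" "Q m i k j" using Q by (meson lessThan_iff)
      then have "R T m"
        using T unique unfolding R_def by metis
      then show ?thesis ..
    qed
    then obtain f where f: "\<And>T. T \<in> nsets {..<N} 3 \<Longrightarrow> R T (f T)"
      by metis
    then have "f \<in> nsets {..<N} 3 \<rightarrow> {..<n}"
      by (auto simp: R_def)
    then obtain m H where m: "m < n" and H: "H \<in> nsets {..<N} M" "f ` nsets H 3 \<subseteq> {m}"
      using partn_lstE[OF part, of f n] by (metis length_replicate nth_replicate)
    have "Q m i k j" if "i \<in> H" "k \<in> H" "j \<in> H" "i < k" "k < j" for i k j
    proof -
      have T: "{i,k,j} \<in> nsets H 3"
        using that by (auto simp: nsets_def)
      then have "{i,k,j} \<in> nsets {..<N} 3"
        using H(1) by (auto simp: nsets_def)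
      then show ?thesis
        using f[of "{i,k,j}"] T H(2) that by (auto simp: R_def)
    qed
    then show "\<exists>m<n. \<exists>H\<subseteq>{..<N}. card H = M \<and>
        (\<forall>i\<in>H. \<forall>k\<in>H. \<forall>j\<in>H. i < k \<longrightarrow> k < j \<longrightarrow> Q m i k j)"
      using m H(1) unfolding nsets_def by blast
  qed
qed

text \<open>The code \<open>m\<close> stands for coordinate \<open>m div 2\<close> and direction \<open>(-1) ^ m\<close>.\<close>

lemma axis_parallel_box_separation:
  assumes "axis_parallel_box d B" "p \<in> real_space d" "p \<notin> B"
  shows "\<exists>m<2 * d. \<forall>x\<in>B. (-1) ^ m * x (m div 2) < (-1) ^ m * p (m div 2)"
proof -
  obtain I where I: "\<And>c. c < d \<Longrightarrow> is_interval (I c)" and B: "B = (\<Pi>\<^sub>E c\<in>{..<d}. I c)"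
    using assms(1) unfolding axis_parallel_box_def by blast
  \<comment> \<open>Points of \<open>real_space d\<close> are extensional, so only a coordinate
    below \<open>d\<close> can keep \<open>p\<close> out of the product.\<close>
  obtain c where c: "c < d" "p c \<notin> I c"
    using assms(2,3) unfolding B real_space_def by (auto simp: PiE_iff)
  have mem: "x c \<in> I c" if "x \<in> B" for x
    using that c B by auto
  \<comment> \<open>Points of the interval on both sides of \<open>p c\<close> would, by convexity,
    force \<open>p c\<close> into it.\<close>
  have "(\<forall>y\<in>I c. y < p c) \<or> (\<forall>y\<in>I c. p c < y)"
    using I[OF c(1)] c(2) unfolding is_interval_1 by (meson linorder_le_cases linorder_not_le)
  then show ?thesis
  proof
    assume "\<forall>y\<in>I c. y < p c"
    then show ?thesis
      using c mem by (intro exI[of _ "2 * c"]) auto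
  next
    assume "\<forall>y\<in>I c. p c < y"
    then show ?thesis
      using c mem by (intro exI[of _ "2 * c + 1"]) auto
  qed
qed

lemma ex_four_increasing:
  fixes H :: "'a::linorder set"
  assumes "4 \<le> card H"
  obtains h0 h1 h2 h3 where "{h0, h1, h2, h3} \<subseteq> H" "h0 < h1" "h1 < h2" "h2 < h3"
proof -
  obtain H' where H': "H' \<subseteq> H" "card H' = 4" "finite H'"
    using obtain_subset_with_card_n[OF assms] by blast
  then have "H' \<in> nsets H 4"
    by (simp add: nsets_def)
  then show ?thesis
    using that by (auto simp: ordered_nsets_4_eq)
qed

lemma ex_common_point:
  fixes p :: "nat \<Rightarrow> nat \<Rightarrow> nat \<Rightarrow> real"
  defines "sep \<equiv> \<lambda>B m i k j. \<forall>x\<in>B k. (-1) ^ m * x (m div 2) < (-1) ^ m * p i j (m div 2)"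
  assumes "4 \<le> card H" "finite H"
    and p: "\<And>i j. i \<in> H \<Longrightarrow> j \<in> H \<Longrightarrow> i < j \<Longrightarrow> p i j \<in> B i \<and> p i j \<in> B j"
    and hom: "\<And>i k j. i \<in> H \<Longrightarrow> k \<in> H \<Longrightarrow> j \<in> H \<Longrightarrow> i < k \<Longrightarrow> k < j \<Longrightarrow>
                (if m < n then sep B m i k j else p i j \<in> B k)"
  shows "\<exists>i\<in>H. \<exists>j\<in>H. i < j \<and> (\<forall>k\<in>H. p i j \<in> B k)"
proof -
  obtain h0 h1 h2 h3 where h: "{h0, h1, h2, h3} \<subseteq> H" "h0 < h1" "h1 < h2" "h2 < h3"
    using ex_four_increasing[OF assms(2)] .
  have "\<not> m < n"
  proof
    assume "m < n"
    then have "sep B m h0 h1 h2" "sep B m h1 h2 h3"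
      using hom[of h0 h1 h2] hom[of h1 h2 h3] h by auto
    \<comment> \<open>Each of these points lies in the box from which the other is separated, so
      each would have the strictly smaller signed coordinate. The factor \<open>(-1) ^ m\<close>
      lets one argument serve both directions.\<close>
    moreover have "p h1 h3 \<in> B h1" "p h0 h2 \<in> B h2"
      using p h by auto
    ultimately show False
      unfolding sep_def by (meson order_less_asym)
  qed
  then have inner: "p i j \<in> B k" if "i \<in> H" "k \<in> H" "j \<in> H" "i < k" "k < j" for i k j
    using hom[OF that] by simp
  have "Min H \<in> H" "Max H \<in> H" "Min H \<le> h0" "h3 \<le> Max H"
    using h \<open>finite H\<close> by (auto intro: Min_in Max_in)
  moreover have "p (Min H) (Max H) \<in> B k" if "k \<in> H" for k
  proof -
    have "Min H \<le> k" "k \<le> Max H"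
      using that \<open>finite H\<close> by auto
    \<comment> \<open>The extreme indices are covered by the choice of \<open>p\<close>, those in
      between by \<open>inner\<close>.\<close>
    then consider "k = Min H" | "k = Max H" | "Min H < k" "k < Max H"
      by linarith
    then show ?thesis
      using inner[of "Min H" k "Max H"] p[of "Min H" "Max H"] calculation that h by cases auto
  qed
  moreover have "Min H < Max H"
    using calculation h by linarith
  ultimately show ?thesis
    by blast
qed

text \<open>The colours are the \<open>2 * d\<close> separating codes and one for membership. Asking
  for \<open>M + 4\<close> homogeneous indices provides the four that exclude a separating colour
  and at least \<open>M\<close> boxes through one point of \<open>S\<close>.\<close>

lemma ex_intersecting_boxes:
  fixes d M :: nat
  assumes "0 < M"
  shows "\<exists>N>0. \<forall>(S :: (nat \<Rightarrow> real) set) (B :: nat \<Rightarrow> (nat \<Rightarrow> real) set).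
     S \<subseteq> real_space d \<longrightarrow>
     (\<forall>i<N. axis_parallel_box d (B i)) \<longrightarrow>
     (\<forall>i<N. \<forall>j<N. i \<noteq> j \<longrightarrow> intersecting S B {i, j}) \<longrightarrow>
     (\<exists>J\<subseteq>{..<N}. card J = M \<and> intersecting S B J)"
proof (rule exE[OF ramsey_ordered_triples[of "Suc (2 * d)" "M + 4"]])
  fix N
  assume "0 < N \<and> (\<forall>Q :: nat \<Rightarrow> nat \<Rightarrow> nat \<Rightarrow> nat \<Rightarrow> bool.
       (\<forall>i k j. i < k \<longrightarrow> k < j \<longrightarrow> j < N \<longrightarrow> (\<exists>m<Suc (2 * d). Q m i k j)) \<longrightarrow>
       (\<exists>m<Suc (2 * d). \<exists>H\<subseteq>{..<N}. card H = M + 4 \<and>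
         (\<forall>i\<in>H. \<forall>k\<in>H. \<forall>j\<in>H. i < k \<longrightarrow> k < j \<longrightarrow> Q m i k j)))"
  note N0 = conjunct1[OF this] and N = conjunct2[OF this]
  show ?thesis
  proof (rule exI[of _ N], intro conjI allI impI)
    show "0 < N"
      by (fact N0)
  next
    fix S :: "(nat \<Rightarrow> real) set" and B :: "nat \<Rightarrow> (nat \<Rightarrow> real) set"
    assume S: "S \<subseteq> real_space d" and box: "\<forall>i<N. axis_parallel_box d (B i)"
      and pairs: "\<forall>i<N. \<forall>j<N. i \<noteq> j \<longrightarrow> intersecting S B {i, j}"
    show "\<exists>J\<subseteq>{..<N}. card J = M \<and> intersecting S B J"
    proof -
      have "\<exists>x. x \<in> S \<and> x \<in> B i \<and> x \<in> B j" if "i < j" "j < N" for i j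
      proof -
        have "intersecting S B {i, j}"
          using pairs that by auto
        then show ?thesis
          by (auto simp: intersecting_def)
      qed
      then obtain p where p: "\<And>i j. i < j \<Longrightarrow> j < N \<Longrightarrow> p i j \<in> S \<and> p i j \<in> B i \<and> p i j \<in> B j"
        by metis
      \<comment> \<open>The value \<open>2 * d\<close>, the first beyond the separating codes,
        records that \<open>p i j\<close> lies in the middle box.\<close>
      define Q where "Q m i k j \<longleftrightarrow>
        (if m < 2 * d then \<forall>x\<in>B k. (-1) ^ m * x (m div 2) < (-1) ^ m * p i j (m div 2)
         else p i j \<in> B k)" for m i k j
      have "\<exists>m<Suc (2 * d). Q m i k j" if "i < k" "k < j" "j < N" for i k j
      proof (cases "p i j \<in> B k")
        case True
        then show ?thesis
          by (intro exI[of _ "2 * d"]) (simp add: Q_def)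
      next
        case False
        moreover have "p i j \<in> real_space d" "axis_parallel_box d (B k)"
          using p[of i j] that S box by auto
        ultimately obtain m where "m < 2 * d"
          "\<forall>x\<in>B k. (-1) ^ m * x (m div 2) < (-1) ^ m * p i j (m div 2)"
          using axis_parallel_box_separation by blast
        then show ?thesis
          by (intro exI[of _ m]) (simp add: Q_def)
      qed
      then have "\<forall>i k j. i < k \<longrightarrow> k < j \<longrightarrow> j < N \<longrightarrow> (\<exists>m<Suc (2 * d). Q m i k j)"
        by blast
      from mp[OF spec[OF N, of Q] this] obtain m H where H: "H \<subseteq> {..<N}" "card H = M + 4"
        and hom: "\<And>i k j. i \<in> H \<Longrightarrow> k \<in> H \<Longrightarrow> j \<in> H \<Longrightarrow> i < k \<Longrightarrow> k < j \<Longrightarrow> Q m i k j"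
        by blast
      have "4 \<le> card H"
        using H(2) by simp
      moreover have "finite H"
        using H(1) finite_subset by blast
      ultimately have "\<exists>i\<in>H. \<exists>j\<in>H. i < j \<and> (\<forall>k\<in>H. p i j \<in> B k)"
      proof (rule ex_common_point[where n = "2 * d" and m = m])
        show "p i j \<in> B i \<and> p i j \<in> B j" if "i \<in> H" "j \<in> H" "i < j" for i j
          using p[of i j] that H(1) by auto
        show "if m < 2 * d then \<forall>x\<in>B k. (-1) ^ m * x (m div 2) < (-1) ^ m * p i j (m div 2)
              else p i j \<in> B k" if "i \<in> H" "k \<in> H" "j \<in> H" "i < k" "k < j" for i k j
          using hom[OF that] unfolding Q_def .
      qed
      then obtain i j where ij: "i \<in> H" "j \<in> H" "i < j" "\<forall>k\<in>H. p i j \<in> B k"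
        by blast
      then have "p i j \<in> S"
        using p[of i j] H(1) by auto
      \<comment> \<open>The common point survives in every subfamily, so \<open>H\<close> can be
        trimmed to size exactly \<open>M\<close>; \<open>0 < M\<close> keeps the result
        nonempty.\<close>
      obtain J where J: "J \<subseteq> H" "card J = M"
        using obtain_subset_with_card_n[of M H] H(2) by auto
      then have "p i j \<in> (\<Inter>k\<in>J. B k) \<inter> S"
        using \<open>p i j \<in> S\<close> ij(4) by auto
      moreover have "J \<noteq> {}"
        using J assms by auto
      ultimately have "intersecting S B J"
        unfolding intersecting_def by blast
      then show ?thesis
        using J H(1) by blast
    qed
  qed
qed

theorem theorem1p3:
  "\<exists>N :: nat \<Rightarrow> nat. \<forall>d>0. N d > 0 \<and>
     (\<forall>(S :: (nat \<Rightarrow> real) set) (B :: nat \<Rightarrow> (nat \<Rightarrow> real) set).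
        S \<subseteq> real_space d \<longrightarrow>
        (\<forall>i<N d. axis_parallel_box d (B i)) \<longrightarrow>
        (\<forall>i<N d. \<forall>j<N d. i \<noteq> j \<longrightarrow> intersecting S B {i, j}) \<longrightarrow>
        (\<exists>J\<subseteq>{..<N d}. card J = d + 1 \<and> intersecting S B J))"
  \<comment> \<open>A bound is found for each dimension separately; the axiom of choice collects
    these bounds into a function.\<close>
  apply (rule choice, rule allI)
  subgoal for d
    using ex_intersecting_boxes[of "d + 1" d] by blast
  done

end
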